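(* Assume that $P(x,y)>0$ for all $x,y\in X$ and that there is a constant $C_*\ge 1$ with $P_2(x,y)\le C_*P(x,y)$ for all $x,y\in X$; that $\sup_{x,y\in X}P(x,y)/\mu(y)<\infty$; and that the potential $V$ is confining. Assume that both semigroups $\{\mathcal U_n:n\in\mathbb N_0\}$ and $\{\widehat{\mathcal U}_n:n\in\mathbb N_0\}$ are pIUC with respect to some exhausting sequence $(A_n)$. Fix $p\in(1,\infty)$. Then there exist $C>0$ and $\rho=\rho(p)\in(0,1)$ such that for sufficiently large $n\in\mathbb N$ we have $$\sup_{x\in A_{n-1}}\ \sup_{\|f\|_{\ell^p(\nu)}\le1}\big|\mathcal Q_nf(x)-\bar\nu(f)\big|\le C\rho^n.$$ This statement remains true for the dual semigroup $\{\widehat{\mathcal Q}_n:n\in\mathbb N_0\}$.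
   Context: $X$ is a countably infinite set, $\mathbb N=\{1,2,\dots\}$, $\mathbb N_0=\mathbb N\cup\{0\}$. $P:X\times X\to[0,1]$ is a (sub-)probability kernel, i.e. $\sum_{y\in X}P(x,y)\le1$ for all $x$. It is assumed throughout that there are a (sub-)probability kernel $\widehat P:X\times X\to[0,1]$ and a measure $\mu:X\to(0,\infty)$ with $\mu(x)P(x,y)=\mu(y)\widehat P(y,x)$ for all $x,y\in X$. Put $P_2(x,y)=\sum_{z\in X}P(x,z)P(z,y)$. A potential is a function $V:X\to(0,\infty)$ with $\inf_{x\in X}V(x)>0$ (standing assumption). It is confining if for every $M\in\mathbb N$ there is a finite set $B_M\subset X$ with $V(x)\ge M$ for all $x\in X\setminus B_M$. Let $\mathcal U f(x)=\frac1{V(x)}\sum_{y}P(x,y)f(y)$ and $\widehat{\mathcal U}f(x)=\sum_y\widehat P(x,y)\frac1{V(y)}f(y)$; these are mutually adjoint on $\ell^2(\mu)$. Let $\mathcal U_n=\mathcal U^n$, $\widehat{\mathcal U}_n=\widehat{\mathcal U}^n$, with kernels with respect to $\mu$ given by $u_1(x,y)=\frac{P(x,y)}{V(x)\mu(y)}$, $u_{n+1}(x,y)=\sum_zu_n(x,z)u_1(z,y)\mu(z)$ and $\widehat u_n(x,y)=u_n(y,x)$. Under the hypotheses of the claim, $\mathcal U,\widehat{\mathcal U}$ are compact on $\ell^2(\mu)$ and $\lambda_0:=\sup_{\lambda\in\sigma(\mathcal U)}|\lambda|=\sup_{\lambda\in\sigma(\widehat{\mathcal U})}|\lambda|>0$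 is a simple eigenvalue of both; $\varphi_0,\widehat\varphi_0$ denote the corresponding strictly positive eigenfunctions, $\mathcal U\varphi_0=\lambda_0\varphi_0$, $\widehat{\mathcal U}\widehat\varphi_0=\lambda_0\widehat\varphi_0$, normalized by $\|\varphi_0\|_{\ell^2(\mu)}=\|\widehat\varphi_0\|_{\ell^2(\mu)}=1$. Let $\nu(x)=\varphi_0(x)\widehat\varphi_0(x)\mu(x)$, a finite measure with total mass $\|\nu\|=\sum_x\nu(x)$, and $\bar\nu(f)=\frac1{\|\nu\|}\sum_yf(y)\nu(y)$. The intrinsic semigroups are $\mathcal Q_nf=\lambda_0^{-n}\varphi_0^{-1}\,\mathcal U_n(f\varphi_0)$ and $\widehat{\mathcal Q}_nf=\lambda_0^{-n}\widehat\varphi_0^{-1}\,\widehat{\mathcal U}_n(f\widehat\varphi_0)$. A sequence $(A_n)_{n\in\mathbb N}$ of subsets of $X$ is exhausting if $A_n\subseteq A_{n+1}$ and $\bigcup_nA_n=X$. $\{\mathcal U_n\}$ is pIUC (progressively intrinsically ultracontractive) with respect to $(A_n)$ if there are $n_0\in\mathbb N$, $c>0$ with $u_n(x,y)\le c\lambda_0^n\varphi_0(x)\widehat\varphi_0(y)$ for all $n\ge n_0$, $x\in A_n$, $y\in X$; $\{\widehat{\mathcal U}_n\}$ is pIUC with respect to $(A_n)$ if there are $n_0\in\mathbb N$, $c>0$ with $\widehat u_n(x,y)\le c\lambda_0^n\widehat\varphi_0(x)\varphi_0(y)$ for all $n\ge n_0$, $x\in A_n$, $y\in X$. *)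

theory Defs
  imports "HOL-Analysis.Analysis"
begin

(* The state space X is a whole type 'a, assumed countably infinite in the theorem. Sequences that
   are indexed by the positive integers are functions on nat whose value at 0 is never used. *)

definition subprob_kernel :: "('a \<Rightarrow> 'a \<Rightarrow> real) \<Rightarrow> bool" where
  "subprob_kernel P \<longleftrightarrow>
     (\<forall>x y. 0 \<le> P x y \<and> P x y \<le> 1) \<and>
     (\<forall>x. P x summable_on UNIV \<and> (\<Sum>\<^sub>\<infinity>y. P x y) \<le> 1)"

definition kernel2 :: "('a \<Rightarrow> 'a \<Rightarrow> real) \<Rightarrow> 'a \<Rightarrow> 'a \<Rightarrow> real" where
  "kernel2 P x y = (\<Sum>\<^sub>\<infinity>z. P x z * P z y)"

definition potential :: "('a \<Rightarrow> real) \<Rightarrow> bool" where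
  "potential V \<longleftrightarrow> (\<forall>x. 0 < V x) \<and> 0 < (INF x. V x)"

definition confining :: "('a \<Rightarrow> real) \<Rightarrow> bool" where
  "confining V \<longleftrightarrow> (\<forall>M::nat. M \<ge> 1 \<longrightarrow> (\<exists>B. finite B \<and> (\<forall>x. x \<notin> B \<longrightarrow> real M \<le> V x)))"


definition ellp :: "real \<Rightarrow> ('a \<Rightarrow> real) \<Rightarrow> ('a \<Rightarrow> 'b::real_normed_vector) set" where
  "ellp p m = {f. (\<lambda>x. norm (f x) powr p * m x) summable_on UNIV}"

definition ellp_norm :: "real \<Rightarrow> ('a \<Rightarrow> real) \<Rightarrow> ('a \<Rightarrow> 'b::real_normed_vector) \<Rightarrow> real" where
  "ellp_norm p m f = (\<Sum>\<^sub>\<infinity>x. norm (f x) powr p * m x) powr (1 / p)"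

(* Spectrum of an operator T on the complex space l^2(m): the complement of the set of z for which
   T - z is a bijection of l^2(m) with bounded inverse. *)
definition ell2_spectrum ::
    "('a \<Rightarrow> real) \<Rightarrow> (('a \<Rightarrow> complex) \<Rightarrow> ('a \<Rightarrow> complex)) \<Rightarrow> complex set" where
  "ell2_spectrum m T = {z. \<not> (
      bij_betw (\<lambda>f x. T f x - z * f x) (ellp 2 m) (ellp 2 m) \<and>
      (\<exists>c. \<forall>f \<in> ellp 2 m. ellp_norm 2 m f \<le> c * ellp_norm 2 m (\<lambda>x. T f x - z * f x)))}"


(* The values lie in an arbitrary normed space so that the same operators act on complex functions
   (for the spectrum) and on real functions (everywhere else). *)
definition opU :: "('a \<Rightarrow> 'a \<Rightarrow> real) \<Rightarrow> ('a \<Rightarrow> real) \<Rightarrow> ('a \<Rightarrow> 'b::real_normed_vector) \<Rightarrow> 'a \<Rightarrow> 'b" where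
  "opU P V f x = (1 / V x) *\<^sub>R (\<Sum>\<^sub>\<infinity>y. P x y *\<^sub>R f y)"

definition opUhat :: "('a \<Rightarrow> 'a \<Rightarrow> real) \<Rightarrow> ('a \<Rightarrow> real) \<Rightarrow> ('a \<Rightarrow> 'b::real_normed_vector) \<Rightarrow> 'a \<Rightarrow> 'b" where
  "opUhat Phat V f x = (\<Sum>\<^sub>\<infinity>y. (Phat x y * (1 / V y)) *\<^sub>R f y)"

definition lambda0 :: "('a \<Rightarrow> 'a \<Rightarrow> real) \<Rightarrow> ('a \<Rightarrow> real) \<Rightarrow> ('a \<Rightarrow> real) \<Rightarrow> real" where
  "lambda0 P V \<mu> = (SUP z \<in> ell2_spectrum \<mu> (opU P V). cmod z)"

definition kern1 :: "('a \<Rightarrow> 'a \<Rightarrow> real) \<Rightarrow> ('a \<Rightarrow> real) \<Rightarrow> ('a \<Rightarrow> real) \<Rightarrow> 'a \<Rightarrow> 'a \<Rightarrow> real" where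
  "kern1 P V \<mu> x y = P x y / (V x * \<mu> y)"

(* At n = 0: the kernel of the identity with respect to mu. *)
fun kern :: "('a \<Rightarrow> 'a \<Rightarrow> real) \<Rightarrow> ('a \<Rightarrow> real) \<Rightarrow> ('a \<Rightarrow> real) \<Rightarrow> nat \<Rightarrow> 'a \<Rightarrow> 'a \<Rightarrow> real" where
  "kern P V \<mu> 0 x y = (if x = y then 1 / \<mu> x else 0)"
| "kern P V \<mu> (Suc 0) x y = kern1 P V \<mu> x y"
| "kern P V \<mu> (Suc (Suc n)) x y = (\<Sum>\<^sub>\<infinity>z. kern P V \<mu> (Suc n) x z * kern1 P V \<mu> z y * \<mu> z)"

definition kernhat :: "('a \<Rightarrow> 'a \<Rightarrow> real) \<Rightarrow> ('a \<Rightarrow> real) \<Rightarrow> ('a \<Rightarrow> real) \<Rightarrow> nat \<Rightarrow> 'a \<Rightarrow> 'a \<Rightarrow> real" where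
  "kernhat P V \<mu> n x y = kern P V \<mu> n y x"


definition exhausting :: "(nat \<Rightarrow> 'a set) \<Rightarrow> bool" where
  "exhausting A \<longleftrightarrow> (\<forall>n\<ge>1. A n \<subseteq> A (Suc n)) \<and> (\<Union>n\<in>{1..}. A n) = UNIV"

(* For the dual semigroup this is used with kernhat and with phi and psi exchanged. *)
definition pIUC ::
    "(nat \<Rightarrow> 'a \<Rightarrow> 'a \<Rightarrow> real) \<Rightarrow> real \<Rightarrow> ('a \<Rightarrow> real) \<Rightarrow> ('a \<Rightarrow> real) \<Rightarrow> (nat \<Rightarrow> 'a set) \<Rightarrow> bool" where
  "pIUC u l \<phi> \<psi> A \<longleftrightarrow>
     (\<exists>n0\<ge>1. \<exists>c>0. \<forall>n\<ge>n0. \<forall>x\<in>A n. \<forall>y. u n x y \<le> c * l ^ n * \<phi> x * \<psi> y)"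

(* Normalised strictly positive eigenfunction in l^2(m) of T with eigenvalue l. *)
definition pos_eigenfunction ::
    "('a \<Rightarrow> real) \<Rightarrow> (('a \<Rightarrow> real) \<Rightarrow> ('a \<Rightarrow> real)) \<Rightarrow> real \<Rightarrow> ('a \<Rightarrow> real) \<Rightarrow> bool" where
  "pos_eigenfunction m T l \<phi> \<longleftrightarrow>
     \<phi> \<in> ellp 2 m \<and> (\<forall>x. 0 < \<phi> x) \<and> (\<forall>x. T \<phi> x = l * \<phi> x) \<and> ellp_norm 2 m \<phi> = 1"

definition nu :: "('a \<Rightarrow> real) \<Rightarrow> ('a \<Rightarrow> real) \<Rightarrow> ('a \<Rightarrow> real) \<Rightarrow> 'a \<Rightarrow> real" where
  "nu \<phi> \<psi> \<mu> x = \<phi> x * \<psi> x * \<mu> x"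

definition mean :: "('a \<Rightarrow> real) \<Rightarrow> ('a \<Rightarrow> real) \<Rightarrow> real" where
  "mean m f = (1 / (\<Sum>\<^sub>\<infinity>x. m x)) * (\<Sum>\<^sub>\<infinity>y. f y * m y)"

(* T is opU or opUhat, phi the corresponding ground state, l the common eigenvalue. *)
definition intrinsic ::
    "(('a \<Rightarrow> real) \<Rightarrow> ('a \<Rightarrow> real)) \<Rightarrow> real \<Rightarrow> ('a \<Rightarrow> real) \<Rightarrow> nat \<Rightarrow> ('a \<Rightarrow> real) \<Rightarrow> 'a \<Rightarrow> real" where
  "intrinsic T l \<phi> n f x = (1 / l ^ n) * (1 / \<phi> x) * (T ^^ n) (\<lambda>y. f y * \<phi> y) x"

end

theory Submission
  imports Defs
begin

text \<open>With respect to \<open>\<nu>\<close> the intrinsic semigroup has the one-step density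
  \<open>q x y = u\<^sub>1(x,y) / (\<lambda>\<^sub>0 \<phi>(x) \<phi>hat(y))\<close>, whose row and column integrals are all 1, and the dual
  semigroup has the transposed density. Because \<open>V\<close> is confining and \<open>P\<^sub>2 \<le> C\<^sub>* P\<close>, one has
  \<open>V(x) \<phi>(x) \<le> D P(x,x\<^sub>0)\<close> and \<open>\<phi>hat(y) \<le> D Phat(y,x\<^sub>0)\<close>, so that
  \<open>\<lambda>\<^sub>0 \<phi>(x) \<phi>hat(y) V(x) \<mu>(y)\<close> is at most a multiple of \<open>P(x,x\<^sub>0) P(x\<^sub>0,y) \<le> C\<^sub>* P(x,y)\<close>. Hence
  \<open>q \<ge> \<delta> > 0\<close> everywhere (Doeblin's condition), and the density \<open>q\<^sub>n\<close> of the \<open>n\<close>-th power exceeds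
  \<open>(1 - \<theta>\<^sup>n) / \<parallel>\<nu>\<parallel>\<close>, which gives total variation decay uniformly in the starting point. On \<open>A n\<close>
  pIUC bounds \<open>q\<^sub>n\<close> from above, and interpolating the two bounds yields the estimate for
  \<open>f \<in> \<ell>\<^sup>p(\<nu>)\<close>.\<close>

section \<open>Interchange and comparison of unconditional sums\<close>

text \<open>Fubini in the form in which the estimates below supply its hypothesis: absolute iterated
  summability gives summability on the product set, and all three claims follow from that.\<close>

lemma abs_iterated_summable_swap:
  fixes f :: "'a \<Rightarrow> 'b \<Rightarrow> real"
  assumes "\<And>x. (\<lambda>y. \<bar>f x y\<bar>) summable_on UNIV"
    and "(\<lambda>x. \<Sum>\<^sub>\<infinity>y. \<bar>f x y\<bar>) summable_on UNIV"
  shows "(\<lambda>x. f x y) summable_on UNIV"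
    and "(\<lambda>y. \<Sum>\<^sub>\<infinity>x. f x y) summable_on UNIV"
    and "(\<Sum>\<^sub>\<infinity>x. \<Sum>\<^sub>\<infinity>y. f x y) = (\<Sum>\<^sub>\<infinity>y. \<Sum>\<^sub>\<infinity>x. f x y)"
proof -
  have "(\<lambda>p. norm ((\<lambda>(x, y). f x y) p)) summable_on (UNIV \<times> UNIV)"
    using assms unfolding Infinite_Sum.abs_summable_on_Sigma_iff
    by (simp add: infsum_nonneg)
  then have prod: "(\<lambda>(x, y). f x y) summable_on (UNIV \<times> UNIV)"
    by (rule abs_summable_summable)
  then have swapped: "(\<lambda>(y, x). f x y) summable_on (UNIV \<times> UNIV)"
    by (subst summable_on_swap) (simp add: case_prod_unfold prod.swap_def o_def)
  show "(\<lambda>x. f x y) summable_on UNIV"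
    using summable_on_SigmaD1[OF swapped] by simp
  show "(\<lambda>y. \<Sum>\<^sub>\<infinity>x. f x y) summable_on UNIV"
    using summable_on_Sigma_banach[OF swapped] by simp
  show "(\<Sum>\<^sub>\<infinity>x. \<Sum>\<^sub>\<infinity>y. f x y) = (\<Sum>\<^sub>\<infinity>y. \<Sum>\<^sub>\<infinity>x. f x y)"
    using infsum_swap_banach[OF prod] by simp
qed

lemma term_le_infsum:
  fixes f :: "'a \<Rightarrow> real"
  assumes "f summable_on UNIV" and "\<And>x. 0 \<le> f x"
  shows "f a \<le> infsum f UNIV"
  using finite_sum_le_infsum[OF assms(1), of "{a}"] assms(2) by simp

text \<open>This gives \<open>nu\<close> finite total mass; the crude bound of a product by the sum
  of the two squares is enough.\<close>

lemma summable_on_mult_ellp2: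
  fixes f g m :: "'a \<Rightarrow> real"
  assumes "f \<in> ellp 2 m" and "g \<in> ellp 2 m" and "\<And>x. 0 \<le> m x"
    and "\<And>x. 0 \<le> f x" and "\<And>x. 0 \<le> g x"
  shows "(\<lambda>x. f x * g x * m x) summable_on UNIV"
proof (rule summable_on_comparison_test)
  show "(\<lambda>x. (f x)\<^sup>2 * m x + (g x)\<^sup>2 * m x) summable_on UNIV"
    using assms(1,2,4,5) by (intro summable_on_add) (auto simp: ellp_def)
  show "f x * g x * m x \<le> (f x)\<^sup>2 * m x + (g x)\<^sup>2 * m x" for x
  proof -
    have "f x * g x \<le> (f x)\<^sup>2 + (g x)\<^sup>2"
      using sum_squares_bound[of "f x" "g x"] mult_nonneg_nonneg[OF assms(4)[of x] assms(5)[of x]]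
      by linarith
    then show ?thesis
      using mult_right_mono[OF _ assms(3)[of x]] by (fastforce simp: algebra_simps)
  qed
qed (use assms in auto)

section \<open>Bistochastic kernels with respect to a finite measure\<close>

definition markov_op :: "('a \<Rightarrow> real) \<Rightarrow> ('a \<Rightarrow> 'a \<Rightarrow> real) \<Rightarrow> ('a \<Rightarrow> real) \<Rightarrow> 'a \<Rightarrow> real" where
  "markov_op m q f x = (\<Sum>\<^sub>\<infinity>y. q x y * f y * m y)"

text \<open>Density of the \<open>n\<close>-th power with respect to \<open>m\<close>, starting from
  the density of the identity. The new factor is appended on the right, as in
  \<open>kern\<close>.\<close>

primrec kpow :: "('a \<Rightarrow> real) \<Rightarrow> ('a \<Rightarrow> 'a \<Rightarrow> real) \<Rightarrow> nat \<Rightarrow> 'a \<Rightarrow> 'a \<Rightarrow> real" where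
  "kpow m q 0 = (\<lambda>x y. if x = y then 1 / m x else 0)"
| "kpow m q (Suc n) = (\<lambda>x y. \<Sum>\<^sub>\<infinity>z. kpow m q n x z * q z y * m z)"

text \<open>The axioms are symmetric in rows and columns, so the dual semigroup is covered by the
  same locale with the transposed density.\<close>

locale bistochastic_kernel =
  fixes m :: "'a \<Rightarrow> real" and q :: "'a \<Rightarrow> 'a \<Rightarrow> real"
  assumes m_pos: "0 < m x"
    and m_summable: "m summable_on UNIV"
    and q_nonneg: "0 \<le> q x y"
    and row_sum: "((\<lambda>y. q x y * m y) has_sum 1) UNIV"
    and column_sum: "((\<lambda>x. q x y * m x) has_sum 1) UNIV"
begin

lemma transpose: "bistochastic_kernel m (\<lambda>x y. q y x)"
  by unfold_locales (auto intro: m_pos m_summable q_nonneg row_sum column_sum)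

lemma m_nonneg: "0 \<le> m x"
  using m_pos by (rule less_imp_le)

text \<open>Column sums 1 preserve the bound \<open>1 / m x\<close>, which is the height of the
  initial point mass. It depends on \<open>x\<close>, and serves as a dominating constant for
  summability.\<close>

lemma kpow_bounds: "0 \<le> kpow m q n x y \<and> kpow m q n x y \<le> 1 / m x"
proof (induction n arbitrary: y)
  case 0
  then show ?case by (simp add: m_nonneg)
next
  case (Suc n)
  have le: "kpow m q n x z * q z y * m z \<le> 1 / m x * (q z y * m z)" for z
    using mult_right_mono[OF conjunct2[OF Suc.IH[of z]], of "q z y * m z"]
    by (simp add: q_nonneg m_nonneg mult.assoc)
  have nonneg: "0 \<le> kpow m q n x z * q z y * m z" for z
    using Suc.IH[of z] by (simp add: q_nonneg m_nonneg)
  have hs: "((\<lambda>z. 1 / m x * (q z y * m z)) has_sum 1 / m x * 1) UNIV"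
    by (intro has_sum_cmult_right column_sum)
  have "(\<Sum>\<^sub>\<infinity>z. kpow m q n x z * q z y * m z) \<le> (\<Sum>\<^sub>\<infinity>z. 1 / m x * (q z y * m z))"
    by (intro infsum_mono summable_on_comparison_test[OF has_sum_imp_summable[OF hs]])
      (auto simp only: le nonneg intro: order.trans[OF nonneg le])
  then show ?case
    using infsumI[OF hs] by (auto intro!: infsum_nonneg nonneg)
qed

lemmas kpow_nonneg = conjunct1[OF kpow_bounds] and kpow_le = conjunct2[OF kpow_bounds]

lemma kpow_summable:
  assumes "(\<lambda>y. \<bar>f y\<bar> * m y) summable_on UNIV"
  shows "(\<lambda>y. kpow m q n x y * f y * m y) summable_on UNIV"
proof -
  have "(\<lambda>y. 1 / m x * (\<bar>f y\<bar> * m y)) summable_on UNIV"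
    by (intro summable_on_cmult_right assms)
  then have "(\<lambda>y. norm (kpow m q n x y * f y * m y)) summable_on UNIV"
    by (rule Infinite_Sum.abs_summable_on_comparison_test')
      (simp only: real_norm_def abs_mult abs_of_nonneg[OF kpow_nonneg] abs_of_nonneg[OF m_nonneg]
        mult.assoc, intro mult_right_mono kpow_le mult_nonneg_nonneg abs_ge_zero m_nonneg)
  then show ?thesis by (rule abs_summable_summable)
qed

text \<open>Summing over \<open>x\<close> first, the column sums reduce the double sum to the
  integral of \<open>\<bar>f\<bar>\<close>; the interchange then settles the other order.\<close>

lemma markov_op_double_sum:
  assumes "(\<lambda>y. \<bar>f y\<bar> * m y) summable_on UNIV"
  shows "(\<lambda>x. \<bar>q x y * f y * m y * m x\<bar>) summable_on UNIV"
    and "(\<lambda>y. \<Sum>\<^sub>\<infinity>x. \<bar>q x y * f y * m y * m x\<bar>) summable_on UNIV"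
    and "(\<lambda>y. \<bar>q x y * f y * m y * m x\<bar>) summable_on UNIV"
    and "(\<lambda>x. \<Sum>\<^sub>\<infinity>y. \<bar>q x y * f y * m y * m x\<bar>) summable_on UNIV"
proof -
  have eq: "\<bar>q x y * f y * m y * m x\<bar> = \<bar>f y\<bar> * m y * (q x y * m x)" for x y
    by (simp add: abs_mult q_nonneg m_nonneg mult_ac)
  have hs: "((\<lambda>x. \<bar>q x y * f y * m y * m x\<bar>) has_sum \<bar>f y\<bar> * m y * 1) UNIV" for y
    unfolding eq by (intro has_sum_cmult_right column_sum)
  show 1: "(\<lambda>x. \<bar>q x y * f y * m y * m x\<bar>) summable_on UNIV" for y
    using hs by (rule has_sum_imp_summable)
  show 2: "(\<lambda>y. \<Sum>\<^sub>\<infinity>x. \<bar>q x y * f y * m y * m x\<bar>) summable_on UNIV"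
    using assms by (simp add: infsumI[OF hs])
  note swap = abs_iterated_summable_swap[of "\<lambda>y x. \<bar>q x y * f y * m y * m x\<bar>",
      unfolded abs_idempotent, OF 1 2]
  show "(\<lambda>y. \<bar>q x y * f y * m y * m x\<bar>) summable_on UNIV"
    and "(\<lambda>x. \<Sum>\<^sub>\<infinity>y. \<bar>q x y * f y * m y * m x\<bar>) summable_on UNIV"
    using swap(1,2) by auto
qed

text \<open>Integrability has to pass to the next iterate in the induction for
  \<open>markov_op_power\<close>.\<close>

lemma markov_op_summable:
  assumes "(\<lambda>y. \<bar>f y\<bar> * m y) summable_on UNIV"
  shows "(\<lambda>x. \<bar>markov_op m q f x\<bar> * m x) summable_on UNIV"
proof (rule summable_on_comparison_test[OF markov_op_double_sum(4)[OF assms]])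
  fix x
  have "\<bar>markov_op m q f x\<bar> * m x = norm (\<Sum>\<^sub>\<infinity>y. q x y * f y * m y * m x)"
    by (simp add: markov_op_def infsum_cmult_left' abs_mult m_nonneg)
  also have "\<dots> \<le> (\<Sum>\<^sub>\<infinity>y. norm (q x y * f y * m y * m x))"
    using markov_op_double_sum(3)[OF assms] by (intro norm_infsum_bound) simp
  finally show "\<bar>markov_op m q f x\<bar> * m x \<le> (\<Sum>\<^sub>\<infinity>y. \<bar>q x y * f y * m y * m x\<bar>)"
    by simp
qed (simp add: m_nonneg)

text \<open>The application next to \<open>f\<close> is peeled off, so the induction hypothesis is
  used for \<open>markov_op m q f\<close>. The interchange of sums is dominated through
  \<open>kpow_le\<close>, uniformly in the intermediate point.\<close>

lemma markov_op_power:
  assumes "(\<lambda>y. \<bar>f y\<bar> * m y) summable_on UNIV"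
  shows "(markov_op m q ^^ n) f x = (\<Sum>\<^sub>\<infinity>y. kpow m q n x y * f y * m y)"
  using assms
proof (induction n arbitrary: f)
  case 0
  have "(\<Sum>\<^sub>\<infinity>y. kpow m q 0 x y * f y * m y) = (\<Sum>\<^sub>\<infinity>y\<in>{x}. kpow m q 0 x y * f y * m y)"
    by (rule infsum_cong_neutral) auto
  then show ?case using m_pos[of x] by simp
next
  case (Suc n)
  let ?g = "\<lambda>y z. kpow m q n x z * (q z y * f y * m y * m z)"
  note S = markov_op_double_sum[OF Suc.prems]
  have le: "\<bar>?g y z\<bar> \<le> 1 / m x * \<bar>q z y * f y * m y * m z\<bar>" for y z
    unfolding abs_mult[of "kpow m q n x z"] abs_of_nonneg[OF kpow_nonneg]
    by (intro mult_right_mono kpow_le abs_ge_zero)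
  have 1: "(\<lambda>z. \<bar>?g y z\<bar>) summable_on UNIV" for y
    by (rule summable_on_comparison_test[OF summable_on_cmult_right[OF S(1)]]) (rule le, simp)
  have 2: "(\<lambda>y. \<Sum>\<^sub>\<infinity>z. \<bar>?g y z\<bar>) summable_on UNIV"
  proof (rule summable_on_comparison_test[OF summable_on_cmult_right[OF S(2)]])
    show "(\<Sum>\<^sub>\<infinity>z. \<bar>?g y z\<bar>) \<le> 1 / m x * (\<Sum>\<^sub>\<infinity>z. \<bar>q z y * f y * m y * m z\<bar>)" for y
      unfolding infsum_cmult_right'[symmetric]
      by (intro infsum_mono 1 summable_on_cmult_right S(1) le)
  qed (simp add: infsum_nonneg)
  have "(markov_op m q ^^ Suc n) f x = (\<Sum>\<^sub>\<infinity>z. kpow m q n x z * markov_op m q f z * m z)"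
    unfolding funpow_Suc_right o_apply by (rule Suc.IH[OF markov_op_summable[OF Suc.prems]])
  also have "\<dots> = (\<Sum>\<^sub>\<infinity>z. \<Sum>\<^sub>\<infinity>y. ?g y z)"
    by (simp only: markov_op_def infsum_cmult_right' infsum_cmult_left' mult.assoc[of "kpow m q n x _"])
  also have "\<dots> = (\<Sum>\<^sub>\<infinity>y. \<Sum>\<^sub>\<infinity>z. ?g y z)"
    by (rule abs_iterated_summable_swap(3)[OF 1 2, symmetric])
  also have "\<dots> = (\<Sum>\<^sub>\<infinity>y. kpow m q (Suc n) x y * f y * m y)"
    by (simp add: infsum_cmult_right' infsum_cmult_left' mult_ac)
  finally show ?case .
qed

text \<open>The operator fixes the constant 1, and \<open>markov_op_power\<close> reads this off as
  a row sum.\<close>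

lemma kpow_row_sum: "((\<lambda>y. kpow m q n x y * m y) has_sum 1) UNIV"
proof -
  have one: "(\<lambda>y. \<bar>1\<bar> * m y) summable_on UNIV"
    using m_summable by simp
  have "markov_op m q (\<lambda>_. 1) = (\<lambda>_. 1)"
    by (rule ext) (simp add: markov_op_def infsumI[OF row_sum])
  then have "(markov_op m q ^^ n) (\<lambda>_. 1) = (\<lambda>_. 1)"
    by (induction n) auto
  then have "(\<Sum>\<^sub>\<infinity>y. kpow m q n x y * m y) = 1"
    using markov_op_power[OF one, of n x] by (simp add: fun_eq_iff)
  then show ?thesis
    using kpow_summable[OF one, of n x] has_sum_infsum by fastforce
qed

text \<open>Applying \<open>markov_op_power\<close> to a point mass turns \<open>Q ^ (n + 1) = Q \<circ> Q ^ n\<close> into the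
  recursion on the left factor, so that no separate associativity argument is needed.\<close>

lemma kpow_Suc_left: "kpow m q (Suc n) x y = (\<Sum>\<^sub>\<infinity>z. q x z * kpow m q n z y * m z)"
proof -
  let ?f = "\<lambda>z. if z = y then 1 / m y else 0"
  have f: "(\<lambda>z. \<bar>?f z\<bar> * m z) summable_on UNIV"
    by (rule finite_nonzero_values_imp_summable_on) (auto intro: finite_subset[of _ "{y}"])
  have pow: "(markov_op m q ^^ k) ?f z = kpow m q k z y" for k z
  proof -
    have "(markov_op m q ^^ k) ?f z = (\<Sum>\<^sub>\<infinity>w\<in>{y}. kpow m q k z w * ?f w * m w)"
      unfolding markov_op_power[OF f] by (rule infsum_cong_neutral) auto
    then show ?thesis using m_pos[of y] by simp
  qed
  have "kpow m q (Suc n) x y = markov_op m q ((markov_op m q ^^ n) ?f) x"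
    using pow[of "Suc n" x] by simp
  also have "(markov_op m q ^^ n) ?f = (\<lambda>z. kpow m q n z y)"
    using pow by auto
  finally show ?thesis by (simp add: markov_op_def)
qed

text \<open>Transposition turns the recursion on the right factor into the one on the left, which is
  \<open>kpow_Suc_left\<close>.\<close>

lemma kpow_transpose: "kpow m (\<lambda>x y. q y x) n x y = kpow m q n y x"
proof (induction n arbitrary: y)
  case (Suc n)
  show ?case
    unfolding kpow_Suc_left[of n y x] by (simp add: Suc.IH mult_ac)
qed simp

text \<open>Doeblin iteration. Let \<open>a\<close> be the bound for \<open>n\<close> and
  \<open>N\<close> the mass of \<open>m\<close>. Integrating
  \<open>(kpow m q n x z - a) * (q z y - \<delta>) \<ge> 0\<close> over \<open>z\<close>, where rows
  of \<open>kpow\<close> and columns of \<open>q\<close> sum to 1, gives the lower bound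
  \<open>\<delta> * (1 - a * N) + a\<close>, which is the one for \<open>n + 1\<close>.\<close>

lemma kpow_lower_bound:
  assumes "\<And>x y. \<delta> \<le> q x y" and "\<theta> = 1 - \<delta> * (\<Sum>\<^sub>\<infinity>x. m x)" and "0 \<le> \<theta>"
  shows "(1 - \<theta> ^ n) / (\<Sum>\<^sub>\<infinity>x. m x) \<le> kpow m q n x y"
proof (induction n arbitrary: y)
  case 0
  then show ?case using kpow_nonneg[of 0 x y] by simp
next
  case (Suc n)
  define N where "N = (\<Sum>\<^sub>\<infinity>x. m x)"
  have N: "0 < N"
    using term_le_infsum[OF m_summable m_nonneg, of x] m_pos[of x] by (simp add: N_def)
  have m_sum: "(m has_sum N) UNIV"
    unfolding N_def using m_summable by (rule has_sum_infsum)
  define a where "a = (1 - \<theta> ^ n) / N"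
  have 1: "((\<lambda>z. \<delta> * (kpow m q n x z * m z + (- a) * m z) + a * (q z y * m z)) has_sum
      \<delta> * (1 + (- a) * N) + a * 1) UNIV"
    by (intro has_sum_add has_sum_cmult_right kpow_row_sum m_sum column_sum)
  have 2: "((\<lambda>z. kpow m q n x z * q z y * m z) has_sum kpow m q (Suc n) x y) UNIV"
  proof -
    have "(\<lambda>z. kpow m q n x z * q z y * m z) summable_on UNIV"
      by (rule kpow_summable) (use column_sum in \<open>auto simp: q_nonneg intro: has_sum_imp_summable\<close>)
    then show ?thesis using has_sum_infsum by fastforce
  qed
  have "\<delta> * (1 + (- a) * N) + a * 1 \<le> kpow m q (Suc n) x y"
  proof (rule has_sum_mono[OF 1 2])
    fix z
    have "0 \<le> (kpow m q n x z - a) * (q z y - \<delta>) * m z"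
      using Suc.IH[of z] assms(1)[of z y] m_nonneg[of z] unfolding a_def N_def by simp
    then show "\<delta> * (kpow m q n x z * m z + (- a) * m z) + a * (q z y * m z) \<le> kpow m q n x z * q z y * m z"
      by (simp add: algebra_simps)
  qed
  moreover have "\<delta> * (1 + (- a) * N) + a * 1 = (1 - \<theta> ^ Suc n) / N"
  proof -
    have "\<delta> = (1 - \<theta>) / N" using N assms(2) by (simp add: N_def)
    moreover have "1 + (- a) * N = \<theta> ^ n" using N by (simp add: a_def)
    ultimately show ?thesis
      by (simp only: a_def) (simp add: add_divide_distrib[symmetric] algebra_simps)
  qed
  ultimately show ?case by (simp add: N_def)
qed

text \<open>The part of the density above the constant of \<open>kpow_lower_bound\<close> has mass
  \<open>\<theta> ^ n\<close> and is at most \<open>c\<close>. Cutting \<open>f\<close> at a level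
  uses the small mass where \<open>f\<close> is small and the bound \<open>c\<close> where
  \<open>f\<close> is large.\<close>

lemma markov_op_power_mean_bound:
  assumes \<delta>: "\<And>x y. \<delta> \<le> q x y" "\<theta> = 1 - \<delta> * (\<Sum>\<^sub>\<infinity>x. m x)" "0 < \<theta>" "\<theta> < 1"
    and p: "1 < p" and c: "\<And>y. kpow m q n x y \<le> c"
    and f: "f \<in> ellp p m" "ellp_norm p m f \<le> 1"
  shows "\<bar>(markov_op m q ^^ n) f x - mean m f\<bar>
    \<le> (2 + c + 1 / (\<Sum>\<^sub>\<infinity>x. m x)) * (\<theta> powr (1 - 1 / p)) ^ n"
proof -
  define N where "N = (\<Sum>\<^sub>\<infinity>x. m x)"
  have N: "0 < N"
    using term_le_infsum[OF m_summable m_nonneg, of x] m_pos[of x] by (simp add: N_def)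
  have m_sum: "(m has_sum N) UNIV"
    unfolding N_def using m_summable by (rule has_sum_infsum)
  define S where "S = (\<Sum>\<^sub>\<infinity>y. \<bar>f y\<bar> powr p * m y)"
  have S_sum: "((\<lambda>y. \<bar>f y\<bar> powr p * m y) has_sum S) UNIV"
    unfolding S_def using f(1) by (intro has_sum_infsum) (simp add: ellp_def)
  have S: "S \<le> 1"
  proof (rule ccontr)
    assume "\<not> S \<le> 1"
    then have "1 < S powr (1 / p)" using p by (intro gr_one_powr) auto
    then show False using f(2) by (simp add: ellp_norm_def S_def)
  qed
  have S_nonneg: "0 \<le> S"
    unfolding S_def by (intro infsum_nonneg) (simp add: m_nonneg)
  \<comment> \<open>Above the level \<open>t\<close> the factor
    \<open>(\<bar>f y\<bar> / t) powr (p - 1)\<close> is at least 1 and may be inserted.\<close>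
  have split: "\<bar>f y\<bar> \<le> t + t powr (1 - p) * \<bar>f y\<bar> powr p" if t: "0 < t" for t y
  proof (cases "\<bar>f y\<bar> \<le> t")
    case False
    then have "(t / \<bar>f y\<bar>) powr (p - 1) \<le> 1"
      using t p by (intro powr_le1) auto
    then have "(\<bar>f y\<bar> / t) powr (p - 1) \<ge> 1"
      using t False by (simp add: powr_divide field_simps)
    then have "\<bar>f y\<bar> * 1 \<le> \<bar>f y\<bar> * (\<bar>f y\<bar> / t) powr (p - 1)"
      by (intro mult_left_mono) auto
    also have "\<dots> = t powr (1 - p) * \<bar>f y\<bar> powr p"
    proof -
      have "\<bar>f y\<bar> powr p = \<bar>f y\<bar> * \<bar>f y\<bar> powr (p - 1)"
        using False t by (simp add: powr_mult_base)
      moreover have "t powr (1 - p) = 1 / t powr (p - 1)"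
        using powr_minus_divide[of t "p - 1"] by simp
      ultimately show ?thesis using t by (simp add: powr_divide)
    qed
    finally show ?thesis using t by simp
  qed (simp add: add_increasing2)
  \<comment> \<open>The level 1 in \<open>split\<close>, together with the finite mass of
    \<open>m\<close>, makes \<open>f\<close> integrable.\<close>
  have f_bound: "((\<lambda>y. m y + \<bar>f y\<bar> powr p * m y) has_sum N + S) UNIV"
    by (intro has_sum_add m_sum S_sum)
  have f_le: "\<bar>f y\<bar> * m y \<le> m y + \<bar>f y\<bar> powr p * m y" for y
    using mult_right_mono[OF split[of 1 y] m_nonneg[of y]] by (simp add: algebra_simps)
  have f_int: "(\<lambda>y. \<bar>f y\<bar> * m y) summable_on UNIV"
    by (rule summable_on_comparison_test[OF has_sum_imp_summable[OF f_bound]])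
      (simp_all add: f_le m_nonneg)
  have fm_sum: "((\<lambda>y. f y * m y) has_sum N * mean m f) UNIV"
  proof -
    have "(\<lambda>y. norm (f y * m y)) summable_on UNIV"
      using f_int by (simp add: abs_mult m_nonneg)
    then have "(\<lambda>y. f y * m y) summable_on UNIV"
      by (rule abs_summable_summable)
    then show ?thesis using N has_sum_infsum by (fastforce simp: mean_def N_def)
  qed
  have mean_le: "\<bar>mean m f\<bar> \<le> 1 + 1 / N"
  proof -
    have "norm (N * mean m f) \<le> N + S"
      by (rule norm_infsum_le[OF fm_sum f_bound]) (simp add: abs_mult m_nonneg f_le)
    then show ?thesis using N S by (simp add: abs_mult field_simps)
  qed
  define a where "a = (1 - \<theta> ^ n) / N"
  have aN: "a * N = 1 - \<theta> ^ n" using N by (simp add: a_def)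
  \<comment> \<open>The excess over the Doeblin bound: a row of mass 1 loses \<open>a * N\<close>,
    which leaves \<open>\<theta> ^ n\<close>.\<close>
  define h where "h = (\<lambda>y. kpow m q n x y - a)"
  have h_nonneg: "0 \<le> h y" for y
    using kpow_lower_bound[OF \<delta>(1,2), of n x y] \<delta>(3) by (simp add: h_def a_def N_def)
  have h_le: "h y \<le> c" for y
  proof -
    have "\<theta> ^ n \<le> 1" using \<delta>(3,4) by (intro power_le_one) auto
    then have "0 \<le> a" using N by (simp add: a_def)
    then show ?thesis using c[of y] by (simp add: h_def)
  qed
  have c_nonneg: "0 \<le> c" using h_nonneg h_le order.trans by blast
  have h_sum: "((\<lambda>y. h y * m y) has_sum \<theta> ^ n) UNIV"
  proof -
    have "((\<lambda>y. kpow m q n x y * m y + (- a) * m y) has_sum 1 + (- a) * N) UNIV"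
      by (intro has_sum_add has_sum_cmult_right kpow_row_sum m_sum)
    moreover have "1 + (- a) * N = \<theta> ^ n" using aN by simp
    ultimately have "((\<lambda>y. kpow m q n x y * m y + (- a) * m y) has_sum \<theta> ^ n) UNIV"
      by (simp only:)
    then show ?thesis by (simp add: h_def algebra_simps)
  qed
  have hf_sum: "((\<lambda>y. h y * f y * m y) has_sum
      (markov_op m q ^^ n) f x + (- a) * (N * mean m f)) UNIV"
  proof -
    have "((\<lambda>y. kpow m q n x y * f y * m y) has_sum (markov_op m q ^^ n) f x) UNIV"
      unfolding markov_op_power[OF f_int] by (intro has_sum_infsum kpow_summable f_int)
    then have "((\<lambda>y. kpow m q n x y * f y * m y + (- a) * (f y * m y)) has_sum
        (markov_op m q ^^ n) f x + (- a) * (N * mean m f)) UNIV"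
      by (intro has_sum_add has_sum_cmult_right fm_sum)
    then show ?thesis by (simp add: h_def algebra_simps)
  qed
  \<comment> \<open>this cut-off level balances the two terms of the bound obtained from \<open>split\<close>\<close>
  define t where "t = \<theta> powr (- (real n / p))"
  define \<rho> where "\<rho> = \<theta> powr (1 - 1 / p)"
  have t: "0 < t" using \<delta>(3) by (simp add: t_def)
  have \<rho>_pow: "\<rho> ^ n = \<theta> powr (real n * (1 - 1 / p))"
    using \<delta>(3) by (simp add: \<rho>_def powr_powr powr_realpow[symmetric] mult.commute)
  have "norm ((markov_op m q ^^ n) f x + (- a) * (N * mean m f))
      \<le> t * \<theta> ^ n + t powr (1 - p) * c * S"
  proof (rule norm_infsum_le[OF hf_sum])
    show "((\<lambda>y. t * (h y * m y) + t powr (1 - p) * c * (\<bar>f y\<bar> powr p * m y)) has_sum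
      t * \<theta> ^ n + t powr (1 - p) * c * S) UNIV"
      by (intro has_sum_add has_sum_cmult_right h_sum S_sum)
    fix y
    have "norm (h y * f y * m y) = \<bar>f y\<bar> * (h y * m y)"
      by (simp add: abs_mult h_nonneg m_nonneg)
    also have "\<dots> \<le> (t + t powr (1 - p) * \<bar>f y\<bar> powr p) * (h y * m y)"
      by (intro mult_right_mono split t mult_nonneg_nonneg h_nonneg m_nonneg)
    also have "\<dots> = t * (h y * m y) + h y * (t powr (1 - p) * (\<bar>f y\<bar> powr p * m y))"
      by (simp add: algebra_simps)
    also have "\<dots> \<le> t * (h y * m y) + c * (t powr (1 - p) * (\<bar>f y\<bar> powr p * m y))"
      by (intro add_left_mono mult_right_mono h_le) (simp add: m_nonneg)
    finally show "norm (h y * f y * m y)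
        \<le> t * (h y * m y) + t powr (1 - p) * c * (\<bar>f y\<bar> powr p * m y)"
      by (simp add: mult_ac)
  qed
  also have "t * \<theta> ^ n = \<rho> ^ n"
    using \<delta>(3) by (simp add: \<rho>_pow t_def powr_realpow[symmetric] powr_add[symmetric] algebra_simps)
  also have "t powr (1 - p) = \<rho> ^ n"
  proof -
    have "- (real n / p) * (1 - p) = real n * (1 - 1 / p)" using p by (simp add: field_simps)
    then show ?thesis by (simp only: \<rho>_pow t_def powr_powr)
  qed
  also have "\<rho> ^ n * c * S \<le> \<rho> ^ n * c"
    using mult_left_mono[OF S, of "\<rho> ^ n * c"] c_nonneg by (simp add: \<rho>_def)
  finally have 1: "\<bar>(markov_op m q ^^ n) f x + (- a) * (N * mean m f)\<bar> \<le> \<rho> ^ n + \<rho> ^ n * c"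
    by simp
  have 2: "\<theta> ^ n * \<bar>mean m f\<bar> \<le> \<rho> ^ n * (1 + 1 / N)"
  proof (rule mult_mono[OF _ mean_le])
    have "\<theta> powr 1 \<le> \<rho>"
      unfolding \<rho>_def using \<delta>(3,4) p by (intro powr_mono') auto
    then show "\<theta> ^ n \<le> \<rho> ^ n" using \<delta>(3) by (intro power_mono) auto
  qed (use N in \<open>simp_all add: \<rho>_def\<close>)
  \<comment> \<open>As \<open>a * N = 1 - \<theta> ^ n\<close>, the subtracted term misses the mean
    by \<open>\<theta> ^ n * mean m f\<close>.\<close>
  have "(markov_op m q ^^ n) f x - mean m f
      = ((markov_op m q ^^ n) f x + (- a) * (N * mean m f)) - \<theta> ^ n * mean m f"
    by (simp add: mult.assoc[symmetric] aN left_diff_distrib)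
  then have "\<bar>(markov_op m q ^^ n) f x - mean m f\<bar>
      \<le> \<bar>(markov_op m q ^^ n) f x + (- a) * (N * mean m f)\<bar> + \<bar>\<theta> ^ n * mean m f\<bar>"
    by (simp only: abs_triangle_ineq4)
  also have "\<bar>\<theta> ^ n * mean m f\<bar> = \<theta> ^ n * \<bar>mean m f\<bar>"
    using \<delta>(3) by (simp add: abs_mult)
  also have "\<bar>(markov_op m q ^^ n) f x + (- a) * (N * mean m f)\<bar> + \<theta> ^ n * \<bar>mean m f\<bar>
      \<le> (2 + c + 1 / N) * \<rho> ^ n"
    using 1 2 by (simp add: algebra_simps)
  finally show ?thesis by (simp add: N_def \<rho>_def)
qed

text \<open>The estimate is uniform because \<open>c\<close> depends neither on \<open>n\<close> nor
  on the point of \<open>A n\<close>, and \<open>A (n - 1)\<close> lies in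
  \<open>A n\<close>.\<close>

lemma markov_op_power_geometric:
  assumes \<delta>: "0 < \<delta>" "\<And>x y. \<delta> \<le> q x y" and p: "1 < p"
    and c: "0 < c" "\<And>n x y. \<lbrakk>n0 \<le> n; x \<in> A n\<rbrakk> \<Longrightarrow> kpow m q n x y \<le> c"
    and A: "\<And>n. 1 \<le> n \<Longrightarrow> A n \<subseteq> A (Suc n)"
  shows "\<exists>C>0. \<exists>\<rho>. 0 < \<rho> \<and> \<rho> < 1 \<and>
    (\<forall>\<^sub>F n in sequentially.
      (SUP x \<in> A (n - 1). SUP f \<in> {f \<in> ellp p m. ellp_norm p m f \<le> 1}.
        ennreal \<bar>(markov_op m q ^^ n) f x - mean m f\<bar>) \<le> ennreal (C * \<rho> ^ n))"
proof -
  define N where "N = (\<Sum>\<^sub>\<infinity>x. m x)"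
  have N: "0 < N"
    using term_le_infsum[OF m_summable m_nonneg, of undefined] m_pos[of undefined]
    by (simp add: N_def)
  have "\<delta> * N \<le> 1"
  proof (rule has_sum_mono[OF _ row_sum])
    show "((\<lambda>y. \<delta> * m y) has_sum \<delta> * N) UNIV"
      unfolding N_def by (intro has_sum_cmult_right has_sum_infsum m_summable)
  qed (intro mult_right_mono \<delta> m_nonneg)
  \<comment> \<open>Half of \<open>\<delta>\<close> keeps \<open>\<theta>\<close> strictly positive
    even if \<open>\<delta> * N = 1\<close>; otherwise \<open>\<rho>\<close> could be 0.\<close>
  define \<theta> where "\<theta> = 1 - \<delta> / 2 * N"
  have \<theta>: "0 < \<theta>" "\<theta> < 1" using \<open>\<delta> * N \<le> 1\<close> N \<delta>(1) by (auto simp: \<theta>_def)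
  have half: "\<delta> / 2 \<le> q x y" for x y using \<delta>(1) \<delta>(2)[of x y] by simp
  define C where "C = 2 + c + 1 / N"
  define \<rho> where "\<rho> = \<theta> powr (1 - 1 / p)"
  have "\<forall>\<^sub>F n in sequentially.
      (SUP x \<in> A (n - 1). SUP f \<in> {f \<in> ellp p m. ellp_norm p m f \<le> 1}.
        ennreal \<bar>(markov_op m q ^^ n) f x - mean m f\<bar>) \<le> ennreal (C * \<rho> ^ n)"
    \<comment> \<open>With \<open>n \<ge> 2\<close> the index \<open>n - 1\<close> is at least 1,
      where monotonicity of \<open>A\<close> is available.\<close>
    using eventually_ge_at_top[of "max n0 2"]
  proof eventually_elim
    case (elim n)
    then have "A (n - 1) \<subseteq> A n" using A[of "n - 1"] by (cases n) auto
    then show ?case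
      unfolding C_def \<rho>_def N_def using elim
      by (intro SUP_least ennreal_leI
          markov_op_power_mean_bound[OF half \<theta>_def[unfolded N_def] \<theta> p] c(2)) auto
  qed
  moreover have "0 < C" using c(1) N by (simp add: C_def add_pos_pos)
  moreover have "0 < \<rho>" "\<rho> < 1"
    using \<theta> p powr_less_mono'[of \<theta> 0 "1 - 1 / p"] by (simp_all add: \<rho>_def)
  ultimately show ?thesis by blast
qed

end

section \<open>Domination of eigenfunctions by a column of the kernel\<close>

text \<open>Since \<open>\<kappa> F \<le> C F\<close> by the assumption on \<open>kernel2\<close>, the part of the eigenvalue equation where
  \<open>V\<close> is large can be absorbed into the left-hand side; only a finite set of sites remains.\<close>

lemma eigenfunction_le_kernel:
  assumes \<kappa>: "subprob_kernel \<kappa>" "\<And>x y. 0 < \<kappa> x y" "\<And>x y. kernel2 \<kappa> x y \<le> C * \<kappa> x y"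
    and V: "confining V" "\<And>x. 0 < V x" and F: "\<And>x. 0 < F x" and l: "0 < l" and C: "0 < C"
    and eigen: "\<And>x. ((\<lambda>y. \<kappa> x y * (F y / V y)) has_sum l * F x) UNIV"
  shows "\<exists>D>0. \<forall>x. F x \<le> D * \<kappa> x x0"
proof -
  define G where "G = (\<lambda>y. F y / V y)"
  have G: "0 < G y" for y by (simp add: G_def F V)
  have eigenG: "((\<lambda>y. \<kappa> x y * G y) has_sum l * F x) UNIV" for x
    unfolding G_def by (rule eigen)
  have k2: "(\<lambda>z. \<kappa> x z * \<kappa> z y) summable_on UNIV" for x y
  proof (rule summable_on_comparison_test)
    show "\<kappa> x summable_on UNIV" using \<kappa>(1) by (simp add: subprob_kernel_def)
    show "\<kappa> x z * \<kappa> z y \<le> \<kappa> x z" for z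
      using \<kappa>(1) by (simp add: subprob_kernel_def mult_left_le)
  qed (simp add: \<kappa>(2) less_imp_le)
  \<comment> \<open>Applying the kernel to the eigenvalue equation: \<open>l\<close> times the sum
    is the two-step kernel applied to \<open>G\<close>, hence at most \<open>C\<close> times the
    one-step kernel applied to \<open>G\<close>, which is \<open>C * l * F x\<close>. The
    interchange also yields the summability claimed here.\<close>
  have \<kappa>F: "(\<lambda>y. \<kappa> x y * F y) summable_on UNIV \<and> (\<Sum>\<^sub>\<infinity>y. \<kappa> x y * F y) \<le> C * F x" for x
  proof -
    let ?f = "\<lambda>z y. \<kappa> x y * \<kappa> y z * G z"
    have f_pos: "\<bar>?f z y\<bar> = ?f z y" for z y by (simp add: \<kappa>(2) G less_imp_le)
    have sum_f: "(\<Sum>\<^sub>\<infinity>y. ?f z y) = kernel2 \<kappa> x z * G z" for z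
      by (simp add: kernel2_def infsum_cmult_left')
    have CG: "((\<lambda>z. C * (\<kappa> x z * G z)) has_sum C * (l * F x)) UNIV"
      by (intro has_sum_cmult_right eigenG)
    have le: "kernel2 \<kappa> x z * G z \<le> C * (\<kappa> x z * G z)" for z
      using mult_right_mono[OF \<kappa>(3)[of x z] less_imp_le[OF G[of z]]] by (simp add: mult.assoc)
    have 0: "(\<lambda>z. kernel2 \<kappa> x z * G z) summable_on UNIV"
    proof (rule summable_on_comparison_test[OF has_sum_imp_summable[OF CG] le])
      show "0 \<le> kernel2 \<kappa> x z * G z" for z
        unfolding kernel2_def
        by (intro mult_nonneg_nonneg infsum_nonneg) (simp_all add: \<kappa>(2) G less_imp_le)
    qed
    have 1: "(\<lambda>y. \<bar>?f z y\<bar>) summable_on UNIV" for z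
      unfolding f_pos by (intro summable_on_cmult_left k2)
    have 2: "(\<lambda>z. \<Sum>\<^sub>\<infinity>y. \<bar>?f z y\<bar>) summable_on UNIV"
      unfolding f_pos sum_f by (rule 0)
    note swap = abs_iterated_summable_swap[OF 1 2]
    have eq: "(\<Sum>\<^sub>\<infinity>z. ?f z y) = l * (\<kappa> x y * F y)" for y
      using infsumI[OF eigenG[of y]] by (simp add: infsum_cmult_right' mult.assoc)
    have "(\<lambda>y. 1 / l * (l * (\<kappa> x y * F y))) summable_on UNIV"
      using swap(2) unfolding eq by (rule summable_on_cmult_right)
    then have "(\<lambda>y. \<kappa> x y * F y) summable_on UNIV" using l by simp
    moreover have "l * (\<Sum>\<^sub>\<infinity>y. \<kappa> x y * F y) \<le> l * (C * F x)"
    proof -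
      have "l * (\<Sum>\<^sub>\<infinity>y. \<kappa> x y * F y) = (\<Sum>\<^sub>\<infinity>z. kernel2 \<kappa> x z * G z)"
        using swap(3) unfolding eq sum_f by (simp add: infsum_cmult_right')
      also have "\<dots> \<le> (\<Sum>\<^sub>\<infinity>z. C * (\<kappa> x z * G z))"
        by (intro infsum_mono 0 has_sum_imp_summable[OF CG] le)
      finally show ?thesis using infsumI[OF CG] by (simp add: mult_ac)
    qed
    ultimately show ?thesis using l by simp
  qed
  \<comment> \<open>This size of \<open>M\<close> makes the sites with large \<open>V\<close>
    contribute at most half of \<open>l * F x\<close>; the successor secures
    \<open>1 \<le> M\<close>, as \<open>confining\<close> demands.\<close>
  obtain M :: nat where M: "1 \<le> M" "2 * C / l \<le> real M"
  proof -
    obtain k :: nat where "2 * C / l \<le> real k" using real_arch_simple by blast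
    then show thesis by (intro that[of "Suc k"]) auto
  qed
  obtain B where B: "finite B" "\<And>x. x \<notin> B \<Longrightarrow> real M \<le> V x"
    using V(1) M(1) unfolding confining_def by blast
  \<comment> \<open>The sum collects the costs of comparing \<open>\<kappa> x y\<close> with
    \<open>\<kappa> x x0\<close> for \<open>y\<close> in \<open>B\<close>, and \<open>2 / l\<close>
    undoes the absorption. The summand 1 keeps \<open>D\<close> positive when \<open>B\<close> is
    empty.\<close>
  define D where "D = 2 / l * (\<Sum>y\<in>B. C * G y / \<kappa> y x0) + 1"
  have "F x \<le> D * \<kappa> x x0" for x
  proof -
    have bound: "((\<lambda>y. 1 / real M * (\<kappa> x y * F y) + (if y \<in> B then \<kappa> x y * G y else 0)) has_sum
        1 / real M * (\<Sum>\<^sub>\<infinity>y. \<kappa> x y * F y) + (\<Sum>y\<in>B. \<kappa> x y * G y)) UNIV"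
      by (intro has_sum_add has_sum_cmult_right has_sum_infsum conjunct1[OF \<kappa>F]
          has_sum_finite_neutralI[OF B(1)]) auto
    have le: "\<kappa> x y * G y \<le> 1 / real M * (\<kappa> x y * F y) + (if y \<in> B then \<kappa> x y * G y else 0)" for y
    proof (cases "y \<in> B")
      case False
      have "G y \<le> F y / real M"
        unfolding G_def using B(2)[OF False] M(1) F[of y] by (intro divide_left_mono) (auto simp: V)
      then show ?thesis
        using False mult_left_mono[OF _ less_imp_le[OF \<kappa>(2)[of x y]]] by fastforce
    qed (simp add: \<kappa>(2) F less_imp_le)
    have "l * F x \<le> 1 / real M * (\<Sum>\<^sub>\<infinity>y. \<kappa> x y * F y) + (\<Sum>y\<in>B. \<kappa> x y * G y)"
      by (rule has_sum_mono[OF eigenG bound le])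
    also have "1 / real M * (\<Sum>\<^sub>\<infinity>y. \<kappa> x y * F y) \<le> 1 / real M * (C * F x)"
      by (intro mult_left_mono conjunct2[OF \<kappa>F]) simp
    also have "\<dots> \<le> l / 2 * F x"
      using M l mult_right_mono[OF M(2), of "F x"] F[of x] by (simp add: field_simps)
    also have "(\<Sum>y\<in>B. \<kappa> x y * G y) \<le> (\<Sum>y\<in>B. \<kappa> x x0 * (C * G y / \<kappa> y x0))"
    proof (rule sum_mono)
      fix y
      \<comment> \<open>Only the path through \<open>y\<close> is kept in the two-step
        kernel.\<close>
      have "\<kappa> x y * \<kappa> y x0 \<le> kernel2 \<kappa> x x0"
        unfolding kernel2_def by (intro term_le_infsum k2) (simp add: \<kappa>(2) less_imp_le)
      also have "\<dots> \<le> C * \<kappa> x x0" by (rule \<kappa>(3))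
      finally have "\<kappa> x y \<le> C * \<kappa> x x0 / \<kappa> y x0"
        by (simp add: pos_le_divide_eq \<kappa>(2))
      from mult_right_mono[OF this less_imp_le[OF G[of y]]]
      show "\<kappa> x y * G y \<le> \<kappa> x x0 * (C * G y / \<kappa> y x0)" by (simp add: mult_ac)
    qed
    finally have "l / 2 * F x \<le> \<kappa> x x0 * (\<Sum>y\<in>B. C * G y / \<kappa> y x0)"
      by (simp add: sum_distrib_left)
    then have "F x \<le> 2 / l * (\<Sum>y\<in>B. C * G y / \<kappa> y x0) * \<kappa> x x0"
      using l by (simp add: field_simps)
    also have "\<dots> \<le> D * \<kappa> x x0"
      by (simp add: D_def \<kappa>(2) less_imp_le distrib_right)
    finally show ?thesis .
  qed
  moreover have "0 < D"
    unfolding D_def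
    by (intro add_nonneg_pos mult_nonneg_nonneg sum_nonneg) (simp_all add: l C G \<kappa>(2) less_imp_le)
  ultimately show ?thesis by blast
qed

theorem proposition6p7:
  fixes P Phat :: "'a \<Rightarrow> 'a \<Rightarrow> real"
    and \<mu> V \<phi> \<phi>hat :: "'a \<Rightarrow> real"
    and A :: "nat \<Rightarrow> 'a set"
    and Cstar p :: real
  defines "\<nu> \<equiv> nu \<phi> \<phi>hat \<mu>"
    and "l0 \<equiv> lambda0 P V \<mu>"
  assumes "countable (UNIV :: 'a set)" and "infinite (UNIV :: 'a set)"
    and "subprob_kernel P" and "subprob_kernel Phat"
    and "\<forall>x. 0 < \<mu> x"
    and "\<forall>x y. \<mu> x * P x y = \<mu> y * Phat y x"
    and "\<forall>x y. 0 < P x y"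
    and "1 \<le> Cstar" and "\<forall>x y. kernel2 P x y \<le> Cstar * P x y"
    and "bdd_above (range (\<lambda>(x, y). P x y / \<mu> y))"
    and "potential V" and "confining V"
    and "pos_eigenfunction \<mu> (opU P V) l0 \<phi>"
    and "pos_eigenfunction \<mu> (opUhat Phat V) l0 \<phi>hat"
    and "exhausting A"
    and "pIUC (kern P V \<mu>) l0 \<phi> \<phi>hat A"
    and "pIUC (kernhat P V \<mu>) l0 \<phi>hat \<phi> A"
    and "1 < p"
  shows "(\<exists>C>0. \<exists>\<rho>. 0 < \<rho> \<and> \<rho> < 1 \<and>
            (\<forall>\<^sub>F n in sequentially.
               (SUP x \<in> A (n - 1). SUP f \<in> {f \<in> ellp p \<nu>. ellp_norm p \<nu> f \<le> 1}.
                  ennreal \<bar>intrinsic (opU P V) l0 \<phi> n f x - mean \<nu> f\<bar>) \<le> ennreal (C * \<rho> ^ n))) \<and>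
         (\<exists>C>0. \<exists>\<rho>. 0 < \<rho> \<and> \<rho> < 1 \<and>
            (\<forall>\<^sub>F n in sequentially.
               (SUP x \<in> A (n - 1). SUP f \<in> {f \<in> ellp p \<nu>. ellp_norm p \<nu> f \<le> 1}.
                  ennreal \<bar>intrinsic (opUhat Phat V) l0 \<phi>hat n f x - mean \<nu> f\<bar>) \<le> ennreal (C * \<rho> ^ n)))"
proof -

  \<comment> \<open>Eigenvalue equations as convergent sums\<close>
  note P = assms(5) and Phat = assms(6) and reversal = assms(8) and P_pos = assms(9)
    and Cstar = assms(10) and P2 = assms(11) and P_bdd = assms(12) and pot = assms(13)
    and conf = assms(14) and \<phi> = assms(15) and \<phi>hat = assms(16) and exh = assms(17)
  have \<mu>: "0 < \<mu> x" for x using assms(7) by simp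
  have V: "0 < V x" for x using pot by (simp add: potential_def)
  have \<phi>_pos: "0 < \<phi> x" and \<phi>hat_pos: "0 < \<phi>hat x" for x
    using \<phi> \<phi>hat by (simp_all add: pos_eigenfunction_def)
  note pos = \<mu> V \<phi>_pos \<phi>hat_pos
  have Phat_eq: "Phat x y = \<mu> y * P y x / \<mu> x" for x y
    using reversal \<mu>[of x] by (simp add: field_simps)
  have Phat_pos: "0 < Phat x y" for x y
    using P_pos by (simp add: Phat_eq \<mu>)
  obtain K where K: "P x y \<le> K * \<mu> y" for x y
    using P_bdd \<mu> by (force simp: bdd_above_def field_simps)
  \<comment> \<open>A divergent \<open>infsum\<close> has value 0, so summability must be known
    before the eigenvalue equations become \<open>has_sum\<close> facts. In
    \<open>g y \<le> 1 + (g y)\<^sup>2\<close> the row sum controls the 1 and the bound by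
    \<open>K * \<mu> y\<close> controls the square.\<close>
  have summable_ellp2: "(\<lambda>y. k y * g y) summable_on UNIV"
    if k: "\<And>y. 0 < k y" "k summable_on UNIV" "\<And>y. k y \<le> K * \<mu> y"
      and g: "g \<in> ellp 2 \<mu>" "\<And>y. 0 < g y" for k g :: "'a \<Rightarrow> real"
  proof (rule summable_on_comparison_test)
    show "(\<lambda>y. k y + K * ((g y)\<^sup>2 * \<mu> y)) summable_on UNIV"
      using g by (intro summable_on_add summable_on_cmult_right k(2)) (simp add: ellp_def less_imp_le)
    fix y
    have "g y \<le> 1 + (g y)\<^sup>2" using sum_squares_bound[of 1 "g y"] g(2)[of y] by simp
    then have "k y * g y \<le> k y * (1 + (g y)\<^sup>2)" by (intro mult_left_mono) (simp_all add: k less_imp_le)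
    also have "\<dots> \<le> k y + K * \<mu> y * (g y)\<^sup>2"
      using mult_right_mono[OF k(3)[of y], of "(g y)\<^sup>2"] by (simp add: distrib_left)
    finally show "k y * g y \<le> k y + K * ((g y)\<^sup>2 * \<mu> y)" by (simp add: mult_ac)
  qed (simp add: k g less_imp_le)
  have P\<phi>_summable: "(\<lambda>y. P x y * \<phi> y) summable_on UNIV" for x
    using P \<phi> K P_pos \<phi>_pos by (intro summable_ellp2) (auto simp: subprob_kernel_def pos_eigenfunction_def)
  have P\<phi>: "((\<lambda>y. P x y * \<phi> y) has_sum l0 * (V x * \<phi> x)) UNIV" for x
  proof -
    have "(\<Sum>\<^sub>\<infinity>y. P x y * \<phi> y) = l0 * (V x * \<phi> x)"
    proof -
      have "(\<Sum>\<^sub>\<infinity>y. P x y * \<phi> y) / V x = l0 * \<phi> x"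
        using \<phi> by (simp add: pos_eigenfunction_def opU_def)
      then show ?thesis using V[of x] by (simp add: field_simps)
    qed
    then show ?thesis using has_sum_infsum[OF P\<phi>_summable[of x]] by simp
  qed
  \<comment> \<open>\<open>l0\<close> is a supremum by definition; its sign is read off from the
    eigenvalue equation, whose terms are positive.\<close>
  have l0: "0 < l0"
  proof -
    have "0 < P undefined undefined * \<phi> undefined" using P_pos \<phi>_pos by simp
    also have "\<dots> \<le> (\<Sum>\<^sub>\<infinity>y. P undefined y * \<phi> y)"
      using P_pos \<phi>_pos by (intro term_le_infsum P\<phi>_summable) (simp add: less_imp_le)
    also have "\<dots> = l0 * (V undefined * \<phi> undefined)" by (rule infsumI[OF P\<phi>])
    finally show ?thesis
      by (rule zero_less_mult_pos2) (simp add: V \<phi>_pos)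
  qed
  have Phat\<phi>hat: "((\<lambda>y. Phat x y * (\<phi>hat y / V y)) has_sum l0 * \<phi>hat x) UNIV" for x
  proof -
    \<comment> \<open>Reversal carries the bound over with the same constant.\<close>
    have "Phat x y \<le> K * \<mu> y" for y
      using mult_right_mono[OF K[of y x], of "\<mu> y / \<mu> x"] \<mu>[of x] \<mu>[of y]
      by (simp add: Phat_eq field_simps)
    then have "(\<lambda>y. Phat x y * \<phi>hat y) summable_on UNIV"
      using Phat \<phi>hat Phat_pos \<phi>hat_pos
      by (intro summable_ellp2) (auto simp: subprob_kernel_def pos_eigenfunction_def)
    then have dom: "(\<lambda>y. 1 / (INF x. V x) * (Phat x y * \<phi>hat y)) summable_on UNIV"
      by (rule summable_on_cmult_right)
    have "(\<lambda>y. Phat x y * (\<phi>hat y / V y)) summable_on UNIV"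
    proof (rule summable_on_comparison_test[OF dom])
      fix y
      have "(INF x. V x) \<le> V y"
        using V by (intro cINF_lower) (auto simp: bdd_below_def intro: less_imp_le)
      then have "1 / V y \<le> 1 / (INF x. V x)"
        using pot V by (intro divide_left_mono) (auto simp: potential_def)
      then show "Phat x y * (\<phi>hat y / V y) \<le> 1 / (INF x. V x) * (Phat x y * \<phi>hat y)"
        using mult_right_mono[of "1 / V y" "1 / (INF x. V x)" "Phat x y * \<phi>hat y"]
          Phat_pos[of x y] \<phi>hat_pos[of y]
        by (simp add: less_imp_le mult_ac)
    qed (simp add: Phat_pos pos less_imp_le)
    moreover have "(\<Sum>\<^sub>\<infinity>y. Phat x y * (\<phi>hat y / V y)) = l0 * \<phi>hat x"
      using \<phi>hat by (simp add: pos_eigenfunction_def opUhat_def)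
    ultimately show ?thesis using has_sum_infsum by metis
  qed

  \<comment> \<open>The intrinsic transition density\<close>
  have \<nu>_eq: "\<nu> x = \<phi> x * \<phi>hat x * \<mu> x" for x by (simp add: assms(1) nu_def)
  define q where "q = (\<lambda>x y. kern1 P V \<mu> x y / (l0 * \<phi> x * \<phi>hat y))"
  have q_nonneg: "0 \<le> q x y" for x y
    using P_pos by (simp add: q_def kern1_def pos l0 less_imp_le)
  \<comment> \<open>In this form the row sums of \<open>q\<close> express the eigenvalue equation of
    \<open>\<phi>\<close>; after reversal the column sums express that of
    \<open>\<phi>hat\<close>.\<close>
  have q_nu: "q x y * \<nu> y = P x y * \<phi> y / (l0 * (V x * \<phi> x))" for x y
    using pos[of x] pos[of y] l0 by (simp add: q_def kern1_def \<nu>_eq field_simps)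
  have nu_q: "q x y * \<nu> x = Phat y x * (\<phi>hat x / V x) / (l0 * \<phi>hat y)" for x y
    using pos[of x] pos[of y] l0 by (simp add: q_def kern1_def \<nu>_eq Phat_eq field_simps)
  interpret Q: bistochastic_kernel \<nu> q
  proof
    show "0 < \<nu> x" for x by (simp add: \<nu>_eq pos)
    show "\<nu> summable_on UNIV"
      unfolding assms(1) nu_def using \<phi> \<phi>hat
      by (intro summable_on_mult_ellp2) (auto simp: pos_eigenfunction_def pos less_imp_le)
    show "((\<lambda>y. q x y * \<nu> y) has_sum 1) UNIV" for x
      using has_sum_cmult_right[OF P\<phi>[of x], of "1 / (l0 * (V x * \<phi> x))"] l0 pos[of x]
      by (simp add: q_nu)
    show "((\<lambda>x. q x y * \<nu> x) has_sum 1) UNIV" for y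
      using has_sum_cmult_right[OF Phat\<phi>hat[of y], of "1 / (l0 * \<phi>hat y)"] l0 pos[of y]
      unfolding nu_q by (simp add: mult_ac)
  qed (rule q_nonneg)
  interpret Qhat: bistochastic_kernel \<nu> "\<lambda>x y. q y x"
    by (rule Q.transpose)

  \<comment> \<open>Kernels and semigroups as powers of the intrinsic density\<close>
  have kern_eq: "kern P V \<mu> n x y = l0 ^ n * \<phi> x * \<phi>hat y * kpow \<nu> q n x y" for n x y
  proof (induction n arbitrary: y)
    case 0
    show ?case using pos[of x] pos[of y] \<nu>_eq[of y] by simp
  next
    case (Suc n)
    have q: "kern1 P V \<mu> z y = l0 * \<phi> z * \<phi>hat y * q z y" for z
      using pos[of z] pos[of y] l0 by (simp add: q_def)
    \<comment> \<open>\<open>kern\<close> has a separate clause at 1; since its value at 0 is a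
      point mass, one recursion covers all \<open>n\<close>.\<close>
    have "kern P V \<mu> (Suc n) x y = (\<Sum>\<^sub>\<infinity>z. kern P V \<mu> n x z * kern1 P V \<mu> z y * \<mu> z)"
    proof (cases n)
      case 0
      have "(\<Sum>\<^sub>\<infinity>z. kern P V \<mu> 0 x z * kern1 P V \<mu> z y * \<mu> z)
          = (\<Sum>\<^sub>\<infinity>z\<in>{x}. kern P V \<mu> 0 x z * kern1 P V \<mu> z y * \<mu> z)"
        by (rule infsum_cong_neutral) auto
      then show ?thesis using 0 \<mu>[of x] by simp
    qed simp
    \<comment> \<open>The factors \<open>\<phi>hat z\<close> and \<open>\<phi> z\<close> of adjacent
      kernels combine with \<open>\<mu> z\<close> to \<open>\<nu> z\<close>.\<close>
    also have "\<dots> = (\<Sum>\<^sub>\<infinity>z. (l0 ^ Suc n * \<phi> x * \<phi>hat y) * (kpow \<nu> q n x z * q z y * \<nu> z))"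
    proof (rule infsum_cong)
      fix z
      show "kern P V \<mu> n x z * kern1 P V \<mu> z y * \<mu> z
          = (l0 ^ Suc n * \<phi> x * \<phi>hat y) * (kpow \<nu> q n x z * q z y * \<nu> z)"
        using \<nu>_eq[of z] by (simp add: Suc.IH q mult_ac)
    qed
    finally show ?case by (simp add: infsum_cmult_right')
  qed

  \<comment> \<open>The constant \<open>c\<close> makes the identity iterable and accumulates to
    \<open>l0 ^ n\<close>. It holds for every \<open>g\<close>, since scalars leave an
    \<open>infsum\<close> even without summability.\<close>
  have opU_eq: "opU P V (\<lambda>y. c * (g y * \<phi> y)) = (\<lambda>x. c * l0 * (markov_op \<nu> q g x * \<phi> x))" for c g
  proof
    fix x
    have "opU P V (\<lambda>y. c * (g y * \<phi> y)) x
        = (\<Sum>\<^sub>\<infinity>y. c * l0 * \<phi> x * (g y * (P x y * \<phi> y / (l0 * (V x * \<phi> x)))))"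
      unfolding opU_def real_scaleR_def infsum_cmult_right'[symmetric]
      using pos[of x] l0 by (intro infsum_cong) (simp add: field_simps)
    also have "\<dots> = c * l0 * \<phi> x * markov_op \<nu> q g x"
      unfolding markov_op_def q_nu[symmetric] by (simp add: infsum_cmult_right'[symmetric] mult_ac)
    finally show "opU P V (\<lambda>y. c * (g y * \<phi> y)) x = c * l0 * (markov_op \<nu> q g x * \<phi> x)"
      by (simp add: mult_ac)
  qed
  have opUhat_eq: "opUhat Phat V (\<lambda>y. c * (g y * \<phi>hat y))
      = (\<lambda>x. c * l0 * (markov_op \<nu> (\<lambda>x y. q y x) g x * \<phi>hat x))" for c g
  proof
    fix x
    have "opUhat Phat V (\<lambda>y. c * (g y * \<phi>hat y)) x
        = (\<Sum>\<^sub>\<infinity>y. c * l0 * \<phi>hat x * (g y * (Phat x y * (\<phi>hat y / V y) / (l0 * \<phi>hat x))))"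
      unfolding opUhat_def real_scaleR_def
      using pos[of x] l0 by (intro infsum_cong) (simp add: field_simps)
    also have "\<dots> = c * l0 * \<phi>hat x * markov_op \<nu> (\<lambda>x y. q y x) g x"
      unfolding markov_op_def nu_q[symmetric] by (simp add: infsum_cmult_right'[symmetric] mult_ac)
    finally show "opUhat Phat V (\<lambda>y. c * (g y * \<phi>hat y)) x
        = c * l0 * (markov_op \<nu> (\<lambda>x y. q y x) g x * \<phi>hat x)"
      by (simp add: mult_ac)
  qed
  have intrinsic_eq: "intrinsic T l0 h n f x = (M ^^ n) f x"
    if T: "\<And>c g. T (\<lambda>y. c * (g y * h y)) = (\<lambda>x. c * l0 * (M g x * h x))" and h: "\<And>x. 0 < h x"
    for T M :: "('a \<Rightarrow> real) \<Rightarrow> 'a \<Rightarrow> real" and h n f x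
  proof -
    have "(T ^^ n) (\<lambda>y. f y * h y) = (\<lambda>x. l0 ^ n * ((M ^^ n) f x * h x))"
      by (induction n) (simp_all add: T mult.commute[of l0])
    then show ?thesis using h[of x] l0 by (simp add: intrinsic_def)
  qed

  \<comment> \<open>Doeblin's condition through a reference point\<close>
  obtain x0 :: 'a where True by simp
  obtain D1 where D1: "0 < D1" "V x * \<phi> x \<le> D1 * P x x0" for x
  proof -
    \<comment> \<open>Here \<open>F\<close> is the product of \<open>V\<close> and
      \<open>\<phi>\<close>, so \<open>F y / V y\<close> is \<open>\<phi> y\<close> and the equation
      required is \<open>P\<phi>\<close>.\<close>
    have "\<exists>D>0. \<forall>x. V x * \<phi> x \<le> D * P x x0"
      using P_pos P2 Cstar P\<phi>
      by (intro eigenfunction_le_kernel[OF P _ _ conf V _ l0, where C = Cstar])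
        (auto simp: pos less_imp_neq[OF V, symmetric])
    then show thesis using that by blast
  qed
  obtain D2 where D2: "0 < D2" "\<phi>hat x \<le> D2 * Phat x x0" for x
  proof -
    \<comment> \<open>Reversal runs two-step paths backwards, so the constant is again
      \<open>Cstar\<close>.\<close>
    have "kernel2 Phat x y \<le> Cstar * Phat x y" for x y
    proof -
      have "kernel2 Phat x y = (\<Sum>\<^sub>\<infinity>z. \<mu> y / \<mu> x * (P y z * P z x))"
        unfolding kernel2_def Phat_eq using \<mu>
        by (intro infsum_cong) (simp add: less_imp_neq[OF \<mu>, symmetric])
      also have "\<dots> = \<mu> y / \<mu> x * kernel2 P y x"
        by (simp only: kernel2_def infsum_cmult_right')
      also have "\<dots> \<le> \<mu> y / \<mu> x * (Cstar * P y x)"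
        using P2 \<mu> by (intro mult_left_mono) (auto simp: less_imp_le)
      finally show ?thesis by (simp add: Phat_eq mult_ac)
    qed
    then have "\<exists>D>0. \<forall>x. \<phi>hat x \<le> D * Phat x x0"
      using Cstar Phat_pos Phat\<phi>hat
      by (intro eigenfunction_le_kernel[OF Phat _ _ conf V _ l0, where C = Cstar]) (auto simp: pos)
    then show thesis using that by blast
  qed
  \<comment> \<open>\<open>D1\<close> and \<open>D2\<close> come from the eigenfunction bounds,
    \<open>\<mu> x0\<close> from expressing \<open>Phat y x0\<close> by \<open>P x0 y\<close>,
    \<open>Cstar\<close> from the path through \<open>x0\<close>, and \<open>l0\<close> from the
    normalisation of \<open>q\<close>.\<close>
  define \<delta> where "\<delta> = 1 / (l0 * D1 * D2 * \<mu> x0 * Cstar)"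
  have \<delta>: "0 < \<delta>" using l0 D1(1) D2(1) \<mu> Cstar by (simp add: \<delta>_def)
  have \<delta>_le: "\<delta> \<le> q x y" for x y
  proof -
    have "(\<lambda>z. P x z * P z y) summable_on UNIV"
    proof (rule summable_on_comparison_test)
      show "P x summable_on UNIV" using P by (simp add: subprob_kernel_def)
    qed (use P in \<open>auto simp: subprob_kernel_def mult_left_le\<close>)
    then have "P x x0 * P x0 y \<le> kernel2 P x y"
      unfolding kernel2_def by (rule term_le_infsum) (simp add: P_pos less_imp_le)
    then have path: "P x x0 * P x0 y \<le> Cstar * P x y"
      using P2 order.trans by blast
    have "(V x * \<phi> x) * (\<mu> y * \<phi>hat y) \<le> (D1 * P x x0) * (\<mu> y * (D2 * Phat y x0))"
      using D1(1) P_pos by (intro mult_mono D1(2) mult_left_mono D2(2)) (auto simp: pos less_imp_le)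
    also have "\<dots> = D1 * D2 * \<mu> x0 * (P x x0 * P x0 y)"
      using \<mu>[of y] by (simp add: Phat_eq)
    also have "\<dots> \<le> D1 * D2 * \<mu> x0 * (Cstar * P x y)"
      using D1(1) D2(1) \<mu>[of x0] path by (intro mult_left_mono) simp_all
    finally have "(V x * \<phi> x) * (\<mu> y * \<phi>hat y) \<le> D1 * D2 * \<mu> x0 * (Cstar * P x y)" .
    then show ?thesis
      using l0 D1(1) D2(1) Cstar pos[of x] pos[of y] \<mu>[of x0]
      by (simp add: \<delta>_def q_def kern1_def field_simps)
  qed

  \<comment> \<open>Upper bounds from pIUC and conclusion\<close>
  obtain n1 c1 where c1: "0 < c1"
    "\<And>n x y. \<lbrakk>n1 \<le> n; x \<in> A n\<rbrakk> \<Longrightarrow> kern P V \<mu> n x y \<le> c1 * l0 ^ n * \<phi> x * \<phi>hat y"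
    using assms(18) unfolding pIUC_def by blast
  obtain n2 c2 where c2: "0 < c2"
    "\<And>n x y. \<lbrakk>n2 \<le> n; x \<in> A n\<rbrakk> \<Longrightarrow> kernhat P V \<mu> n x y \<le> c2 * l0 ^ n * \<phi>hat x * \<phi> y"
    using assms(19) unfolding pIUC_def by blast
  \<comment> \<open>By \<open>kern_eq\<close>, pIUC says exactly that \<open>kpow\<close> is bounded
    on \<open>A n\<close>.\<close>
  have cancel: "k \<le> c" if "l0 ^ n * \<phi> x * \<phi>hat y * k \<le> c * l0 ^ n * \<phi> x * \<phi>hat y" for k c x y n
    using that mult_le_cancel_left_pos[of "l0 ^ n * \<phi> x * \<phi>hat y" k c] l0
    by (simp add: pos mult_ac)
  have kpow_le: "kpow \<nu> q n x y \<le> c1" if "n1 \<le> n" "x \<in> A n" for n x y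
    using c1(2)[OF that, of y] unfolding kern_eq by (rule cancel)
  \<comment> \<open>The dual bound concerns \<open>kern\<close> with exchanged arguments, hence the
    transposed density.\<close>
  have kpow_transpose_le: "kpow \<nu> (\<lambda>x y. q y x) n x y \<le> c2" if "n2 \<le> n" "x \<in> A n" for n x y
    unfolding Q.kpow_transpose
    by (rule cancel[of n y x]) (use c2(2)[OF that, of y] in \<open>simp add: kernhat_def kern_eq mult_ac\<close>)
  have A: "A n \<subseteq> A (Suc n)" if "1 \<le> n" for n
    using exh that by (simp add: exhausting_def)
  show ?thesis
    unfolding intrinsic_eq[where T = "opU P V", OF opU_eq \<phi>_pos]
      intrinsic_eq[where T = "opUhat Phat V", OF opUhat_eq \<phi>hat_pos]
    using Q.markov_op_power_geometric[where A = A, OF \<delta> \<delta>_le assms(20) c1(1) kpow_le A]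
      Qhat.markov_op_power_geometric[where A = A, OF \<delta> \<delta>_le assms(20) c2(1) kpow_transpose_le A]
    by blast
qed

end
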